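(* Fix $\varepsilon>0$, a norm $\|\cdot\|$ (one of the $\mathcal L_{p,\mu}$ norms, $p\in[1,\infty)$, or the supremum norm), and an integer $K^*\ge1$. Suppose there is $q\in(0,1)$ such that $\Pr\{\|\varepsilon_k\|\le\varepsilon\}\ge q$ for all $k\ge0$, this lower bound being independent of $k$ and of $(v_k)_{k\ge0}$. Let $(X_k)_{k\ge0}$ and $(Y_k)_{k\ge0}$ be the processes defined in the context. Then: (i) $X_k\le_{st}Y_k$ for all $k\ge0$. (ii) $\Pr\{Y_k\le\eta\}\le\Pr\{X_k\le\eta\}$ for any $\eta\in\mathbb R$ and all $k\ge0$.
   Context: MDP. $\mathbb S\subset\mathbb R^d$ is compact, $\mathbb A$ is a finite action set, $Q(\cdot|s,a)$ is a transition kernel on $\mathbb S$, $c:\mathbb S\times\mathbb A\to\mathbb R$ is bounded measurable with $|c|\le c_{\max}$, $\gamma\in(0,1)$, $v_{\max}=c_{\max}/(1-\gamma)$; $\mathcal F(\mathbb S;v_{\max})$ is the set of Borel functions on $\mathbb S$ bounded by $v_{\max}$ in absolute value. The Bellman operator is $[Tv](s)=\min_{a\in\mathbb A}\{c(s,a)+\gamma\,\mathbb E_{X\sim Q(\cdot|s,a)}[v(X)]\}$. Random iteration. $\widehat G=\widehat G(\omega)$ is a random operator on $\mathcal F(\mathbb S;v_{\max})$ defined on a probability space $(\Omega,\mathcal B(\Omega),P)$ (a random approximation of $T$). With $\omega_0,\omega_1,\dots$ i.i.d. from $P$ and $v_0\in\mathcal F(\mathbb S;v_{\max})$, set $v_{k+1}=\widehat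 G(\omega_k)v_k$ and $\varepsilon_k=\widehat G(\omega_k)v_k-Tv_k$, so $v_{k+1}=Tv_k+\varepsilon_k$. The hypothesis on $q$ means that the bound $\Pr\{\|\widehat G v_k-Tv_k\|\le\varepsilon\}\ge q$ holds regardless of $k$ and of the value of $v_k$. Processes. Call iteration $k$ "good" if $\|\varepsilon_k\|\le\varepsilon$. On the same probability space as $(v_k)$, the process $(X_k)_{k\ge0}$ has values in $\{1,\dots,K^*\}$ and satisfies $X_{k+1}=\max\{X_k-1,1\}$ if iteration $k$ is good, and $X_{k+1}=K^*$ otherwise. $(Y_k)_{k\ge0}$ is the Markov chain on $\{1,\dots,K^*\}$ with $Y_0=K^*$ and, independently at each step, $Y_{k+1}=\max\{Y_k-1,1\}$ with probability $q$ and $Y_{k+1}=K^*$ with probability $1-q$. Stochastic dominance. $X\le_{st}Y$ means $\mathbb E[f(X)]\le\mathbb E[f(Y)]$ for all increasing $f:\mathbb R\to\mathbb R$; equivalently $\Pr\{X\ge\theta\}\le\Pr\{Y\ge\theta\}$ for all $\theta$ in the support of $Y$. *)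

theory Defs
  imports "HOL-Probability.Probability"
begin

(* Functions on S are represented by their extensional extension, so that an operator on
   this set cannot depend on values outside S. *)
definition bounded_borel_funs :: "'s::euclidean_space set \<Rightarrow> real \<Rightarrow> ('s \<Rightarrow> real) set" where
  "bounded_borel_funs S b =
     {v \<in> borel_measurable (restrict_space borel S) \<inter> extensional S. \<forall>s\<in>S. \<bar>v s\<bar> \<le> b}"

definition bellman ::
    "'s set \<Rightarrow> 'a set \<Rightarrow> ('s \<Rightarrow> 'a \<Rightarrow> 's measure) \<Rightarrow> ('s \<Rightarrow> 'a \<Rightarrow> real) \<Rightarrow> real \<Rightarrow>
     ('s \<Rightarrow> real) \<Rightarrow> 's \<Rightarrow> real" where
  "bellman S A Q c \<gamma> v = (\<lambda>s\<in>S. Min ((\<lambda>a. c s a + \<gamma> * (\<integral>x. v x \<partial>Q s a)) ` A))"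

definition sup_norm_on :: "'s set \<Rightarrow> ('s \<Rightarrow> real) \<Rightarrow> real" where
  "sup_norm_on S f = (SUP s\<in>S. \<bar>f s\<bar>)"

definition Lp_norm :: "real \<Rightarrow> 's measure \<Rightarrow> ('s \<Rightarrow> real) \<Rightarrow> real" where
  "Lp_norm p \<mu> f = (\<integral>s. \<bar>f s\<bar> powr p \<partial>\<mu>) powr (1 / p)"

(* The measure need not be normalised; finiteness makes Lp_norm the actual L^p norm on
   bounded Borel functions. *)
definition sup_or_Lp_norm :: "'s::euclidean_space set \<Rightarrow> (('s \<Rightarrow> real) \<Rightarrow> real) \<Rightarrow> bool" where
  "sup_or_Lp_norm S nrm \<longleftrightarrow>
     nrm = sup_norm_on S \<or>
     (\<exists>p \<mu>. 1 \<le> p \<and> finite_measure \<mu> \<and> sets \<mu> = sets (restrict_space borel S) \<and>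
            nrm = Lp_norm p \<mu>)"

primrec iterates :: "('w \<Rightarrow> 'v \<Rightarrow> 'v) \<Rightarrow> 'v \<Rightarrow> (nat \<Rightarrow> 'w) \<Rightarrow> nat \<Rightarrow> 'v" where
  "iterates G v0 w 0 = v0"
| "iterates G v0 w (Suc k) = G (w k) (iterates G v0 w k)"

definition approx_error ::
    "(('s \<Rightarrow> real) \<Rightarrow> 's \<Rightarrow> real) \<Rightarrow> ('w \<Rightarrow> ('s \<Rightarrow> real) \<Rightarrow> 's \<Rightarrow> real) \<Rightarrow>
     'w \<Rightarrow> ('s \<Rightarrow> real) \<Rightarrow> 's \<Rightarrow> real" where
  "approx_error T G \<omega> v = (\<lambda>s. G \<omega> v s - T v s)"

definition good_iteration ::
    "(('s \<Rightarrow> real) \<Rightarrow> real) \<Rightarrow> real \<Rightarrow> (('s \<Rightarrow> real) \<Rightarrow> 's \<Rightarrow> real) \<Rightarrow>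
     ('w \<Rightarrow> ('s \<Rightarrow> real) \<Rightarrow> 's \<Rightarrow> real) \<Rightarrow> ('s \<Rightarrow> real) \<Rightarrow> (nat \<Rightarrow> 'w) \<Rightarrow> nat \<Rightarrow> bool" where
  "good_iteration nrm \<epsilon> T G v0 w k \<longleftrightarrow>
     nrm (approx_error T G (w k) (iterates G v0 w k)) \<le> \<epsilon>"

definition countdown_step :: "nat \<Rightarrow> bool \<Rightarrow> nat \<Rightarrow> nat" where
  "countdown_step K good x = (if good then max (x - 1) 1 else K)"

definition countdown_kernel :: "nat \<Rightarrow> real \<Rightarrow> nat \<Rightarrow> nat pmf" where
  "countdown_kernel K q x = map_pmf (\<lambda>good. countdown_step K good x) (bernoulli_pmf q)"

(* The last clause is the Markov property with transition kernel \<kappa>, multiplied out so that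
   histories of probability zero need no separate treatment. *)
definition markov_chain ::
    "'n measure \<Rightarrow> (nat \<Rightarrow> 'n \<Rightarrow> 'y) \<Rightarrow> 'y set \<Rightarrow> 'y \<Rightarrow> ('y \<Rightarrow> 'y pmf) \<Rightarrow> bool" where
  "markov_chain N Y E y0 \<kappa> \<longleftrightarrow>
     prob_space N \<and>
     (\<forall>k. Y k \<in> N \<rightarrow>\<^sub>M count_space E) \<and>
     (\<forall>x\<in>space N. Y 0 x = y0) \<and>
     (\<forall>k y. measure N {x\<in>space N. \<forall>i\<le>Suc k. Y i x = y i} =
            measure N {x\<in>space N. \<forall>i\<le>k. Y i x = y i} * pmf (\<kappa> (y k)) (y (Suc k)))"

(* The integrability guards exclude the convention that the integral of a non-integrable
   function is 0; they hold automatically for bounded random variables. *)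
definition stoch_le ::
    "'m measure \<Rightarrow> ('m \<Rightarrow> real) \<Rightarrow> 'n measure \<Rightarrow> ('n \<Rightarrow> real) \<Rightarrow> bool" where
  "stoch_le M X N Y \<longleftrightarrow>
     (\<forall>f::real \<Rightarrow> real. mono f \<longrightarrow> integrable M (\<lambda>x. f (X x)) \<longrightarrow> integrable N (\<lambda>y. f (Y y)) \<longrightarrow>
        (\<integral>x. f (X x) \<partial>M) \<le> (\<integral>y. f (Y y) \<partial>N))"

end

theory Submission
  imports Defs
begin

text \<open>
  The initial value \<open>X\<^sub>0\<close> may depend on the noise, so \<open>X\<close> is first dominated pointwise by the
  countdown started at \<open>K\<close> and driven by the same good iterations; its \<open>k\<close>-th value depends only
  on the noise before time \<open>k\<close>. For \<open>1 \<le> n < K\<close> a countdown is at most \<open>n\<close> at time \<open>k + 1\<close> iff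
  iteration \<open>k\<close> is good and the countdown is at most \<open>n + 1\<close> at time \<open>k\<close>. Integrating out the
  \<open>k\<close>-th noise coordinate first, this has probability at least \<open>q\<close> times that of the latter
  event, whereas for \<open>Y\<close> equality holds. Induction on \<open>k\<close> compares the distribution functions.
\<close>

section \<open>Integrating out one coordinate of a product measure\<close>

text \<open>With the other coordinates fixed, the section of \<open>A\<close> in direction
  \<open>k\<close> is either empty or all of \<open>space (M k)\<close>. In the second case the
  section of \<open>A \<inter> B\<close> is that of \<open>B\<close>, of measure at least
  \<open>q\<close>; integrating over the other coordinates gives the bound. \<open>B\<close> may
  depend on every coordinate, as the error at time \<open>k\<close> does through the current
  iterate.\<close>

lemma measure_PiM_Int_ge:
  assumes M: "\<And>i. i \<in> I \<Longrightarrow> prob_space (M i)" and k: "k \<in> I" and q: "0 \<le> q"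
    and A: "A \<in> sets (PiM I M)" and B: "B \<in> sets (PiM I M)"
    and A_upd: "\<And>w x. w \<in> space (PiM I M) \<Longrightarrow> x \<in> space (M k) \<Longrightarrow> w(k := x) \<in> A \<longleftrightarrow> w \<in> A"
    and B_ge: "\<And>w. w \<in> space (PiM I M) \<Longrightarrow> q \<le> measure (M k) {x \<in> space (M k). w(k := x) \<in> B}"
  shows "q * measure (PiM I M) A \<le> measure (PiM I M) (A \<inter> B)"
proof -
  define R where "R = PiM (I - {k}) M"
  interpret PI: prob_space "PiM I M" by (intro prob_space_PiM M)
  interpret Mk: prob_space "M k" by (rule M[OF k])
  interpret R: prob_space R unfolding R_def by (intro prob_space_PiM M) auto
  interpret pair_sigma_finite "M k" R ..
  let ?h = "\<lambda>(x, f). f(k := x)"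
  have I: "insert k (I - {k}) = I" using k by auto
  have h: "?h \<in> M k \<Otimes>\<^sub>M R \<rightarrow>\<^sub>M PiM I M"
    unfolding R_def
  proof (rule measurable_PiM_single')
    show "(\<lambda>p. (?h p) i) \<in> M k \<Otimes>\<^sub>M PiM (I - {k}) M \<rightarrow>\<^sub>M M i" if "i \<in> I" for i
      using that by (cases "i = k") (auto simp: case_prod_beta intro: measurable_component_singleton)
  qed (use k in \<open>auto simp: space_pair_measure space_PiM PiE_def Pi_def extensional_def\<close>)
  have distr: "distr (M k \<Otimes>\<^sub>M R) (PiM I M) ?h = PiM I M"
    using distr_pair_PiM_eq_PiM[of "I - {k}" M k] M k unfolding R_def I by auto
  have sec: "{x \<in> space (M k). f(k := x) \<in> C} =
      (\<lambda>x. (x, f)) -` (?h -` C \<inter> space (M k \<Otimes>\<^sub>M R))" if "f \<in> space R" for C f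
    using that by (auto simp: space_pair_measure)
  have sec_sets: "{x \<in> space (M k). f(k := x) \<in> C} \<in> sets (M k)"
    if "C \<in> sets (PiM I M)" "f \<in> space R" for C f
    unfolding sec[OF that(2)] by (rule sets_Pair2[OF measurable_sets[OF h that(1)]])
  \<comment> \<open>Tonelli with coordinate \<open>k\<close> innermost; the measurability claim
    serves to pull the constant \<open>q\<close> out of the outer integral.\<close>
  have fubini: "emeasure (PiM I M) C = (\<integral>\<^sup>+f. emeasure (M k) {x \<in> space (M k). f(k := x) \<in> C} \<partial>R)"
    and fubini_meas: "(\<lambda>f. emeasure (M k) {x \<in> space (M k). f(k := x) \<in> C}) \<in> borel_measurable R"
    if C: "C \<in> sets (PiM I M)" for C
  proof -
    note S = measurable_sets[OF h C]
    have "emeasure (PiM I M) C = emeasure (M k \<Otimes>\<^sub>M R) (?h -` C \<inter> space (M k \<Otimes>\<^sub>M R))"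
      by (subst distr[symmetric], rule emeasure_distr[OF h C])
    also have "\<dots> = (\<integral>\<^sup>+f. emeasure (M k) {x \<in> space (M k). f(k := x) \<in> C} \<partial>R)"
      by (subst emeasure_pair_measure_alt2[OF S], rule nn_integral_cong) (simp only: sec)
    finally show "emeasure (PiM I M) C =
      (\<integral>\<^sup>+f. emeasure (M k) {x \<in> space (M k). f(k := x) \<in> C} \<partial>R)" .
    show "(\<lambda>f. emeasure (M k) {x \<in> space (M k). f(k := x) \<in> C}) \<in> borel_measurable R"
      by (subst measurable_cong[OF arg_cong[OF sec]]) (assumption, rule measurable_emeasure_Pair2[OF S])
  qed
  have "ennreal q * emeasure (PiM I M) A
      = (\<integral>\<^sup>+f. ennreal q * emeasure (M k) {x \<in> space (M k). f(k := x) \<in> A} \<partial>R)"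
    by (simp add: fubini[OF A] fubini_meas[OF A] nn_integral_cmult)
  also have "\<dots> \<le> (\<integral>\<^sup>+f. emeasure (M k) {x \<in> space (M k). f(k := x) \<in> A \<inter> B} \<partial>R)"
  proof (rule nn_integral_mono)
    fix f assume f: "f \<in> space R"
    have upd: "f(k := x) \<in> space (PiM I M)" if "x \<in> space (M k)" for x
      using measurable_space[OF h, of "(x, f)"] that f by (simp add: space_pair_measure)
    show "ennreal q * emeasure (M k) {x \<in> space (M k). f(k := x) \<in> A}
        \<le> emeasure (M k) {x \<in> space (M k). f(k := x) \<in> A \<inter> B}"
    proof (cases "\<exists>x0\<in>space (M k). f(k := x0) \<in> A")
      case True
      then obtain x0 where x0: "x0 \<in> space (M k)" "f(k := x0) \<in> A" by auto
      \<comment> \<open>\<open>f\<close> lives on the index set without \<open>k\<close>, so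
        invariance is applied at the completed point \<open>f(k := x0)\<close>, whose coordinate
        \<open>k\<close> is then overwritten.\<close>
      have all: "f(k := x) \<in> A" if "x \<in> space (M k)" for x
        using A_upd[OF upd[OF x0(1)] that] x0(2) by simp
      have "ennreal q * emeasure (M k) {x \<in> space (M k). f(k := x) \<in> A} = ennreal q"
        using all by (simp add: Mk.emeasure_space_1 cong: conj_cong)
      also have "\<dots> \<le> emeasure (M k) {x \<in> space (M k). f(k := x) \<in> B}"
        using B_ge[OF upd[OF x0(1)]] by (simp add: Mk.emeasure_eq_measure)
      also have "{x \<in> space (M k). f(k := x) \<in> B} = {x \<in> space (M k). f(k := x) \<in> A \<inter> B}"
        using all by auto
      finally show ?thesis .
    next
      case False
      then have empty: "{x \<in> space (M k). f(k := x) \<in> A} = {}" by auto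
      show ?thesis unfolding empty by simp
    qed
  qed
  also have "\<dots> = emeasure (PiM I M) (A \<inter> B)"
    using A B by (intro fubini[symmetric]) auto
  finally show ?thesis
    using q by (simp add: PI.emeasure_eq_measure flip: ennreal_mult)
qed

section \<open>The countdown recursion\<close>

text \<open>The bound \<open>1 \<le> n\<close> makes the floor at 1 harmless, and
  \<open>n < K\<close> makes every reset to \<open>K\<close> overshoot \<open>n\<close>.\<close>

lemma countdown_step_le_iff:
  assumes "1 \<le> n" "n < K"
  shows "countdown_step K g x \<le> n \<longleftrightarrow> g \<and> x \<le> Suc n"
  using assms by (auto simp: countdown_step_def)

lemma countdown_step_mono: "x \<le> y \<Longrightarrow> countdown_step K g x \<le> countdown_step K g y"
  by (auto simp: countdown_step_def)

primrec countdown :: "nat \<Rightarrow> (nat \<Rightarrow> bool) \<Rightarrow> nat \<Rightarrow> nat" where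
  "countdown K g 0 = K"
| "countdown K g (Suc k) = countdown_step K (g k) (countdown K g k)"

lemma countdown_bounds:
  assumes "1 \<le> K"
  shows "countdown K g k \<in> {1..K}"
  by (induction k) (use assms in \<open>auto simp: countdown_step_def\<close>)

lemma countdown_cong: "(\<And>i. i < k \<Longrightarrow> g i = h i) \<Longrightarrow> countdown K g k = countdown K h k"
  by (induction k) auto

lemma measurable_countdown:
  assumes "\<And>i. {w \<in> space M. g w i} \<in> sets M"
  shows "(\<lambda>w. countdown K (g w) k) \<in> M \<rightarrow>\<^sub>M count_space UNIV"
proof (induction k)
  case (Suc k)
  have [measurable]: "(\<lambda>w. countdown K (g w) k) \<in> M \<rightarrow>\<^sub>M count_space UNIV"
    "Measurable.pred M (\<lambda>w. g w k)"
    using Suc assms[of k] by (simp_all add: pred_def)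
  show ?case by (simp add: countdown_step_def)
qed simp

lemma iterates_cong: "(\<And>i. i < k \<Longrightarrow> w i = w' i) \<Longrightarrow> iterates G v0 w k = iterates G v0 w' k"
  by (induction k) auto

section \<open>One-step laws of the Markov chain\<close>

text \<open>Kernel counterpart of \<open>countdown_step_le_iff\<close>: the coin outcomes leading
  into \<open>{1..n}\<close> form \<open>{True}\<close> or the empty set, according to the state
  \<open>x\<close>.\<close>

lemma sum_pmf_countdown_kernel:
  assumes "1 \<le> n" "n < K" "0 \<le> q" "q \<le> 1"
  shows "(\<Sum>b\<in>{1..n}. pmf (countdown_kernel K q x) b) = (if x \<le> Suc n then q else 0)"
proof -
  have "(\<Sum>b\<in>{1..n}. pmf (countdown_kernel K q x) b) = measure_pmf.prob (countdown_kernel K q x) {1..n}"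
    by (simp add: measure_measure_pmf_finite)
  also have "\<dots> = measure_pmf.prob (bernoulli_pmf q) {g. countdown_step K g x \<in> {1..n}}"
    by (simp add: countdown_kernel_def vimage_def)
  also have "{g. countdown_step K g x \<in> {1..n}} = (if x \<le> Suc n then {True} else {})"
    using assms by (auto simp: countdown_step_def)
  also have "measure_pmf.prob (bernoulli_pmf q) \<dots> = (if x \<le> Suc n then q else 0)"
    using assms by (simp add: measure_pmf_single)
  finally show ?thesis .
qed

text \<open>The definition of \<open>markov_chain\<close> is the case \<open>m = 0\<close>. Earlier
  times are summed out one by one; the transition factor involves only times \<open>k\<close> and
  \<open>Suc k\<close> and is unaffected. The case \<open>m = k\<close> gives the joint law of two
  consecutive states.\<close>

lemma markov_chain_window:
  assumes Y: "markov_chain N Y E y0 \<kappa>" and E: "finite E" and "m \<le> k"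
  shows "measure N {x \<in> space N. \<forall>i\<in>{m..Suc k}. Y i x = y i} =
    measure N {x \<in> space N. \<forall>i\<in>{m..k}. Y i x = y i} * pmf (\<kappa> (y k)) (y (Suc k))"
  using \<open>m \<le> k\<close>
proof (induction m arbitrary: y)
  case 0
  have "{0..l} = {..l}" for l :: nat by auto
  then show ?case using Y by (simp add: markov_chain_def Ball_def)
next
  case (Suc m)
  interpret N: prob_space N using Y by (simp add: markov_chain_def)
  have Y_meas [measurable]: "Y i \<in> N \<rightarrow>\<^sub>M count_space E" for i
    using Y by (simp add: markov_chain_def)
  \<comment> \<open>Total probability over the state at time \<open>m\<close>, which
    \<open>y(m := a)\<close> prescribes.\<close>
  have split: "measure N {x \<in> space N. \<forall>i\<in>{Suc m..l}. Y i x = y i} =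
      (\<Sum>a\<in>E. measure N {x \<in> space N. \<forall>i\<in>{m..l}. Y i x = (y(m := a)) i})" if "m \<le> l" for l
  proof -
    have "{x \<in> space N. \<forall>i\<in>{Suc m..l}. Y i x = y i} =
        (\<Union>a\<in>E. {x \<in> space N. \<forall>i\<in>{m..l}. Y i x = (y(m := a)) i})"
    proof (intro set_eqI iffI)
      fix x assume x: "x \<in> {x \<in> space N. \<forall>i\<in>{Suc m..l}. Y i x = y i}"
      then have "Y m x \<in> E" using measurable_space[OF Y_meas] by auto
      with x show "x \<in> (\<Union>a\<in>E. {x \<in> space N. \<forall>i\<in>{m..l}. Y i x = (y(m := a)) i})"
        by (intro UN_I[of "Y m x"]) auto
    qed auto
    also have "measure N \<dots> = (\<Sum>a\<in>E. measure N {x \<in> space N. \<forall>i\<in>{m..l}. Y i x = (y(m := a)) i})"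
    proof (rule N.finite_measure_finite_Union[OF E])
      have "{x \<in> space N. \<forall>i\<in>{m..l}. Y i x = (y(m := a)) i} \<in> sets N" for a
        by measurable
      then show "(\<lambda>a. {x \<in> space N. \<forall>i\<in>{m..l}. Y i x = (y(m := a)) i}) ` E \<subseteq> sets N"
        by auto
      \<comment> \<open>Events with different \<open>a\<close> conflict at time \<open>m\<close>,
        which lies in the window because \<open>m \<le> l\<close>.\<close>
      show "disjoint_family_on (\<lambda>a. {x \<in> space N. \<forall>i\<in>{m..l}. Y i x = (y(m := a)) i}) E"
        using that by (fastforce simp: disjoint_family_on_def)
    qed
    finally show ?thesis .
  qed
  \<comment> \<open>Here \<open>m < k\<close>, so \<open>y(m := a)\<close> agrees with
    \<open>y\<close> at \<open>k\<close> and \<open>Suc k\<close>, and the transition factor leaves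
    the sum over \<open>a\<close>.\<close>
  show ?case
    using Suc.prems by (simp add: split Suc.IH sum_distrib_right)
qed

lemma markov_chain_marginal:
  assumes Y: "markov_chain N Y E y0 \<kappa>" and E: "finite E" and B: "B \<subseteq> E"
  shows "measure N {x \<in> space N. Y (Suc k) x \<in> B} =
    (\<Sum>a\<in>E. measure N {x \<in> space N. Y k x = a} * (\<Sum>b\<in>B. pmf (\<kappa> a) b))"
proof -
  interpret N: prob_space N using Y by (simp add: markov_chain_def)
  have Y_meas [measurable]: "Y i \<in> N \<rightarrow>\<^sub>M count_space E" for i
    using Y by (simp add: markov_chain_def)
  have step: "measure N {x \<in> space N. Y k x = a \<and> Y (Suc k) x = b} =
      measure N {x \<in> space N. Y k x = a} * pmf (\<kappa> a) b" for a b
    \<comment> \<open>The window is \<open>{k..Suc k}\<close>; the prescribed path takes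
      \<open>a\<close> at \<open>k\<close> and \<open>b\<close> at \<open>Suc k\<close>.\<close>
    using markov_chain_window[OF Y E order_refl, of k "\<lambda>i. if i = k then a else b"]
    by (simp add: atLeastAtMostSuc_conv conj_commute)
  have fin: "finite B" using B E by (rule finite_subset)
  have "{x \<in> space N. Y (Suc k) x \<in> B} =
      (\<Union>(a, b)\<in>E \<times> B. {x \<in> space N. Y k x = a \<and> Y (Suc k) x = b})"
    using measurable_space[OF Y_meas] by auto
  also have "measure N \<dots> = (\<Sum>(a, b)\<in>E \<times> B. measure N {x \<in> space N. Y k x = a \<and> Y (Suc k) x = b})"
    unfolding case_prod_beta
  proof (rule N.finite_measure_finite_Union)
    have "{x \<in> space N. Y k x = a \<and> Y (Suc k) x = b} \<in> sets N" for a b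
      by measurable
    then show "(\<lambda>p. {x \<in> space N. Y k x = fst p \<and> Y (Suc k) x = snd p}) ` (E \<times> B) \<subseteq> sets N"
      by auto
  qed (use E fin in \<open>auto simp: disjoint_family_on_def\<close>)
  finally show ?thesis
    by (simp add: step sum.cartesian_product[symmetric] sum_distrib_left)
qed

text \<open>Exactly the states up to \<open>n + 1\<close> can enter \<open>{1..n}\<close> in one
  step, each with probability \<open>q\<close>. For the noise-driven countdown the same recursion
  holds only as an inequality.\<close>

lemma markov_countdown_cdf_step:
  assumes Y: "markov_chain N Y {1..K} K (countdown_kernel K q)"
    and n: "1 \<le> n" "n < K" and q: "0 \<le> q" "q \<le> 1"
  shows "measure N {x \<in> space N. Y (Suc k) x \<le> n} = q * measure N {x \<in> space N. Y k x \<le> Suc n}"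
proof -
  interpret N: prob_space N using Y by (simp add: markov_chain_def)
  have Y_meas [measurable]: "Y i \<in> N \<rightarrow>\<^sub>M count_space {1..K}" for i
    using Y by (simp add: markov_chain_def)
  have range: "Y i x \<in> {1..K}" if "x \<in> space N" for i x
    using measurable_space[OF Y_meas that] by simp
  have "{x \<in> space N. Y (Suc k) x \<le> n} = {x \<in> space N. Y (Suc k) x \<in> {1..n}}"
    using range[of _ "Suc k"] by auto
  also have "measure N \<dots> = (\<Sum>a\<in>{1..K}. measure N {x \<in> space N. Y k x = a} *
      (\<Sum>b\<in>{1..n}. pmf (countdown_kernel K q a) b))"
    using n by (intro markov_chain_marginal[OF Y]) auto
  also have "\<dots> = (\<Sum>a\<in>{1..K}. if a \<le> Suc n then q * measure N {x \<in> space N. Y k x = a} else 0)"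
    by (intro sum.cong refl) (simp add: sum_pmf_countdown_kernel[OF n q] del: One_nat_def)
  \<comment> \<open>Since \<open>n < K\<close>, the range \<open>{1..Suc n}\<close> stays inside the
    state space.\<close>
  also have "\<dots> = (\<Sum>a\<in>{1..Suc n}. q * measure N {x \<in> space N. Y k x = a})"
    using n by (intro sum.mono_neutral_cong_right) auto
  also have "\<dots> = q * measure N (\<Union>a\<in>{1..Suc n}. {x \<in> space N. Y k x = a})"
    unfolding sum_distrib_left[symmetric]
    by (subst N.finite_measure_finite_Union) (auto simp: disjoint_family_on_def)
  also have "(\<Union>a\<in>{1..Suc n}. {x \<in> space N. Y k x = a}) = {x \<in> space N. Y k x \<le> Suc n}"
    using range[of _ k] by auto
  finally show ?thesis .
qed

section \<open>Comparison of the distribution functions\<close>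

text \<open>The induction on \<open>k\<close> keeps \<open>n\<close> arbitrary, because level
  \<open>n\<close> at time \<open>k + 1\<close> refers to level \<open>n + 1\<close> at time
  \<open>k\<close>. The bound \<open>good_ge\<close> is uniform in the past, so no conditioning on
  it is required.\<close>

lemma countdown_dominated:
  fixes good :: "(nat \<Rightarrow> 'w) \<Rightarrow> nat \<Rightarrow> bool"
  assumes P: "prob_space P"
    and good_sets: "\<And>k. {w \<in> space (PiM UNIV (\<lambda>_. P)). good w k} \<in> sets (PiM UNIV (\<lambda>_. P))"
    and good_cong: "\<And>k w w'. (\<And>i. i \<le> k \<Longrightarrow> w i = w' i) \<Longrightarrow> good w k = good w' k"
    and good_ge: "\<And>k w. w \<in> space (PiM UNIV (\<lambda>_. P)) \<Longrightarrow>
      q \<le> measure P {x \<in> space P. good (w(k := x)) k}"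
    and q: "0 \<le> q" "q \<le> 1"
    and Y: "markov_chain N Y {1..K} K (countdown_kernel K q)" and K: "1 \<le> K"
  shows "measure N {y \<in> space N. Y k y \<le> n} \<le>
    measure (PiM UNIV (\<lambda>_. P)) {w \<in> space (PiM UNIV (\<lambda>_. P)). countdown K (good w) k \<le> n}"
proof (induction k arbitrary: n)
  let ?P = "PiM UNIV (\<lambda>_::nat. P)"
  interpret PI: prob_space ?P by (intro prob_space_PiM P)
  interpret N: prob_space N using Y by (simp add: markov_chain_def)
  have cd_meas [measurable]: "(\<lambda>w. countdown K (good w) k) \<in> ?P \<rightarrow>\<^sub>M count_space UNIV" for k
    by (rule measurable_countdown) (rule good_sets)
  {
    case 0
    show ?case
    \<comment> \<open>Both processes start at \<open>K\<close>: the right-hand event is certain if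
      \<open>K \<le> n\<close>, and otherwise the left-hand event is empty.\<close>
    proof (cases "K \<le> n")
      case True
      then show ?thesis by (simp add: PI.prob_space)
    next
      case False
      then have "{y \<in> space N. Y 0 y \<le> n} = {}" using Y by (auto simp: markov_chain_def)
      then show ?thesis by (simp only: measure_empty measure_nonneg)
    qed
  next
    case (Suc k)
    have Y_range: "Y i y \<in> {1..K}" if "y \<in> space N" for i y
      using Y that measurable_space[of "Y i" N "count_space {1..K}" y]
      by (simp add: markov_chain_def)
    \<comment> \<open>At \<open>n = 0\<close> the left side vanishes, and for
      \<open>K \<le> n\<close> the right side is 1; the recursion covers the levels between.\<close>
    consider "n = 0" | "K \<le> n" | "1 \<le> n" "n < K" by linarith
    then show ?case
    proof cases
      case 1
      then have "{y \<in> space N. Y (Suc k) y \<le> n} = {}" using Y_range[of _ "Suc k"] by force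
      then show ?thesis by (simp only: measure_empty measure_nonneg)
    next
      case 2
      have "{w \<in> space ?P. countdown K (good w) (Suc k) \<le> n} = space ?P"
        using 2 order_trans[OF _ 2] countdown_bounds[OF K, of _ "Suc k"] by auto
      then show ?thesis by (simp only: PI.prob_space) (rule N.prob_le_1)
    next
      case 3
      let ?A = "{w \<in> space ?P. countdown K (good w) k \<le> Suc n}"
      let ?B = "{w \<in> space ?P. good w k}"
      have "measure N {y \<in> space N. Y (Suc k) y \<le> n} = q * measure N {y \<in> space N. Y k y \<le> Suc n}"
        by (rule markov_countdown_cdf_step[OF Y 3 q])
      also have "\<dots> \<le> q * measure ?P ?A"
        by (intro mult_left_mono Suc.IH q)
      also have "\<dots> \<le> measure ?P (?A \<inter> ?B)"
      proof (rule measure_PiM_Int_ge[where k = k])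
        fix w x assume w: "w \<in> space ?P" and x: "x \<in> space P"
        have "w(k := x) \<in> space ?P"
          using w x by (auto simp: space_PiM PiE_def Pi_def)
        \<comment> \<open>The value at time \<open>k\<close> uses only the flags at times
          \<open>i < k\<close>, and these read coordinates up to \<open>i\<close>, so never
          coordinate \<open>k\<close>.\<close>
        moreover have "countdown K (good (w(k := x))) k = countdown K (good w) k"
          by (intro countdown_cong good_cong) auto
        ultimately show "w(k := x) \<in> ?A \<longleftrightarrow> w \<in> ?A" using w by simp
      next
        fix w assume w: "w \<in> space ?P"
        then have "{x \<in> space P. w(k := x) \<in> ?B} = {x \<in> space P. good (w(k := x)) k}"
          by (auto simp: space_PiM PiE_def Pi_def)
        then show "q \<le> measure P {x \<in> space P. w(k := x) \<in> ?B}"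
          using good_ge[OF w] by simp
      qed (use P q good_sets in auto)
      also have "?A \<inter> ?B = {w \<in> space ?P. countdown K (good w) (Suc k) \<le> n}"
        using 3 by (auto simp: countdown_step_le_iff)
      finally show ?thesis .
    qed
  }
qed

section \<open>From distribution functions to the stochastic order\<close>

text \<open>Abel summation along the values \<open>1, \<dots>, K\<close>; all increments of a monotone \<open>f\<close> enter with a minus sign.\<close>

lemma expectation_eq_cdf:
  fixes f :: "real \<Rightarrow> real"
  assumes M: "prob_space M" and X: "X \<in> M \<rightarrow>\<^sub>M count_space {1..K}"
  shows "(\<integral>x. f (real (X x)) \<partial>M) =
    f (real K) - (\<Sum>n\<in>{1..<K}. (f (real (Suc n)) - f (real n)) * measure M {x \<in> space M. X x \<le> n})"
proof -
  interpret prob_space M by fact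
  note [measurable] = X
  \<comment> \<open>The indicator lets the telescoping sum run over a range that does not depend on
    \<open>m\<close>; for \<open>m = X x\<close> it becomes the indicator of
    \<open>X x \<le> n\<close>.\<close>
  have tele: "f (real K) - f (real m) =
      (\<Sum>n\<in>{1..<K}. (f (real (Suc n)) - f (real n)) * indicator {m..} n)" if "m \<in> {1..K}" for m
  proof -
    have "f (real K) - f (real m) = (\<Sum>n\<in>{m..<K}. f (real (Suc n)) - f (real n))"
      using that by (subst sum_Suc_diff') auto
    also have "\<dots> = (\<Sum>n\<in>{1..<K}. (f (real (Suc n)) - f (real n)) * indicator {m..} n)"
      using that by (intro sum.mono_neutral_cong_left) auto
    finally show ?thesis .
  qed
  have "(\<integral>x. f (real (X x)) \<partial>M) = (\<integral>x. f (real K) -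
      (\<Sum>n\<in>{1..<K}. (f (real (Suc n)) - f (real n)) * indicator {x \<in> space M. X x \<le> n} x) \<partial>M)"
  proof (rule Bochner_Integration.integral_cong[OF refl])
    fix x assume x: "x \<in> space M"
    show "f (real (X x)) = f (real K) -
      (\<Sum>n\<in>{1..<K}. (f (real (Suc n)) - f (real n)) * indicator {x \<in> space M. X x \<le> n} x)"
      using tele[of "X x"] measurable_space[OF X x] x by (simp add: indicator_def)
  qed
  also have "\<dots> = f (real K) -
      (\<Sum>n\<in>{1..<K}. (f (real (Suc n)) - f (real n)) * measure M {x \<in> space M. X x \<le> n})"
  proof -
    have "integrable M (indicator {x \<in> space M. X x \<le> n} :: _ \<Rightarrow> real)" for n
      by (intro integrable_real_indicator) (auto simp: less_top[symmetric])
    then show ?thesis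
      by (simp add: Bochner_Integration.integral_diff Bochner_Integration.integral_sum prob_space
          del: sum_mult_indicator)
  qed
  finally show ?thesis .
qed

text \<open>Both expectations share the term \<open>f (real K)\<close>, and the subtracted sums have
  the same nonnegative weights, so comparing distribution functions at natural levels is
  enough.\<close>

lemma stoch_le_if_cdf_le:
  assumes M: "prob_space M" and X: "X \<in> M \<rightarrow>\<^sub>M count_space {1..K}"
    and N: "prob_space N" and Y: "Y \<in> N \<rightarrow>\<^sub>M count_space {1..K}"
    and le: "\<And>n. measure N {y \<in> space N. Y y \<le> n} \<le> measure M {x \<in> space M. X x \<le> n}"
  shows "stoch_le M (\<lambda>x. real (X x)) N (\<lambda>y. real (Y y))"
  unfolding stoch_le_def expectation_eq_cdf[OF M X] expectation_eq_cdf[OF N Y]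
proof (intro allI impI diff_left_mono sum_mono mult_left_mono le)
  fix f :: "real \<Rightarrow> real" and n :: nat
  assume "mono f"
  then show "0 \<le> f (real (Suc n)) - f (real n)" by (simp add: monoD)
qed

section \<open>Transfer from the path space of the noise to the given processes\<close>

theorem theorem6:
  fixes S :: "'s::euclidean_space set" and A :: "'a set"
    and Q :: "'s \<Rightarrow> 'a \<Rightarrow> 's measure" and c :: "'s \<Rightarrow> 'a \<Rightarrow> real"
    and c_max v_max \<gamma> \<epsilon> q :: real and Kst :: nat
    and nrm :: "('s \<Rightarrow> real) \<Rightarrow> real"
    and T :: "('s \<Rightarrow> real) \<Rightarrow> 's \<Rightarrow> real"
    and P :: "'w measure" and G :: "'w \<Rightarrow> ('s \<Rightarrow> real) \<Rightarrow> 's \<Rightarrow> real" and v0 :: "'s \<Rightarrow> real"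
    and M :: "'m measure" and W :: "nat \<Rightarrow> 'm \<Rightarrow> 'w" and X :: "nat \<Rightarrow> 'm \<Rightarrow> nat"
    and N :: "'n measure" and Y :: "nat \<Rightarrow> 'n \<Rightarrow> nat"
  assumes S: "compact S" "S \<noteq> {}"
    and A: "finite A" "A \<noteq> {}"
    and Q: "\<And>a. a \<in> A \<Longrightarrow>
          (\<lambda>s. Q s a) \<in> restrict_space borel S \<rightarrow>\<^sub>M prob_algebra (restrict_space borel S)"
    and c_meas: "\<And>a. a \<in> A \<Longrightarrow> (\<lambda>s. c s a) \<in> borel_measurable (restrict_space borel S)"
    and c_bound: "\<And>s a. s \<in> S \<Longrightarrow> a \<in> A \<Longrightarrow> \<bar>c s a\<bar> \<le> c_max"
    and \<gamma>: "0 < \<gamma>" "\<gamma> < 1"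
    and v_max: "v_max = c_max / (1 - \<gamma>)"
    and T: "T = bellman S A Q c \<gamma>"
    and \<epsilon>: "0 < \<epsilon>"
    and nrm: "sup_or_Lp_norm S nrm"
    and Kst: "1 \<le> Kst"
    and P: "prob_space P"
    and G: "\<And>\<omega> v. \<omega> \<in> space P \<Longrightarrow> v \<in> bounded_borel_funs S v_max \<Longrightarrow>
          G \<omega> v \<in> bounded_borel_funs S v_max"
    and v0: "v0 \<in> bounded_borel_funs S v_max"
    and good_event: "\<And>k. {w \<in> space (\<Pi>\<^sub>M i\<in>UNIV. P). good_iteration nrm \<epsilon> T G v0 w k}
          \<in> sets (\<Pi>\<^sub>M i\<in>UNIV. P)"
    and q: "0 < q" "q < 1"
    and q_bound: "\<And>k w. w \<in> space (\<Pi>\<^sub>M i\<in>UNIV. P) \<Longrightarrow>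
          q \<le> measure P {\<omega> \<in> space P. nrm (approx_error T G \<omega> (iterates G v0 w k)) \<le> \<epsilon>}"
    and M: "prob_space M"
    and W_indep: "prob_space.indep_vars M (\<lambda>_. P) W UNIV"
    and W_distr: "\<And>k. distr M P (W k) = P"
    and X_meas: "\<And>k. X k \<in> M \<rightarrow>\<^sub>M count_space {1..Kst}"
    and X_step: "\<And>k x. x \<in> space M \<Longrightarrow>
          X (Suc k) x =
            countdown_step Kst (good_iteration nrm \<epsilon> T G v0 (\<lambda>i. W i x) k) (X k x)"
    and Y: "markov_chain N Y {1..Kst} Kst (countdown_kernel Kst q)"
  shows "(\<forall>k. stoch_le M (\<lambda>x. real (X k x)) N (\<lambda>y. real (Y k y))) \<and>
         (\<forall>(\<eta>::real) k. measure N {y \<in> space N. real (Y k y) \<le> \<eta>} \<le>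
                         measure M {x \<in> space M. real (X k x) \<le> \<eta>})"
proof -
  let ?P = "PiM UNIV (\<lambda>_::nat. P)"
  let ?good = "good_iteration nrm \<epsilon> T G v0"
  interpret M: prob_space M by (rule M)
  have N: "prob_space N" and Y_meas: "Y k \<in> N \<rightarrow>\<^sub>M count_space {1..Kst}" for k
    using Y by (auto simp: markov_chain_def)
  have W_meas: "W k \<in> M \<rightarrow>\<^sub>M P" for k
    using W_indep by (simp add: M.indep_vars_def)
  have W_path: "(\<lambda>x i. W i x) \<in> M \<rightarrow>\<^sub>M ?P"
    by (rule measurable_PiM_single') (use W_meas in \<open>auto dest: measurable_space\<close>)
  \<comment> \<open>The noise variables are independent with law \<open>P\<close>, so the law of the
    whole path is the product measure.\<close>
  have distr: "distr M ?P (\<lambda>x i. W i x) = ?P"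
    using W_indep W_distr
    by (subst (asm) M.indep_vars_iff_distr_eq_PiM) (auto simp: W_meas restrict_def)
  \<comment> \<open>The \<open>k\<close>-th iterate uses only noise before time \<open>k\<close>.
    Hence \<open>q_bound\<close>, with the iterate fixed and a fresh noise value, is the bound on
    sections that \<open>countdown_dominated\<close> asks for.\<close>
  have iter_upd: "iterates G v0 (w(k := x)) k = iterates G v0 w k" for w k x
    by (rule iterates_cong) auto
  have good_cong: "?good w k = ?good w' k" if "\<And>i. i \<le> k \<Longrightarrow> w i = w' i" for w w' k
    unfolding good_iteration_def using that iterates_cong[of k w w' G v0] by simp
  have dom: "X k x \<le> countdown Kst (?good (\<lambda>i. W i x)) k" if x: "x \<in> space M" for k x
  proof (induction k)
    case 0
    then show ?case using measurable_space[OF X_meas x] by auto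
  next
    case (Suc k)
    then show ?case by (simp add: X_step[OF x] countdown_step_mono)
  qed
  have cdf: "measure N {y \<in> space N. Y k y \<le> n} \<le> measure M {x \<in> space M. X k x \<le> n}" for k n
  proof -
    let ?C = "{w \<in> space ?P. countdown Kst (?good w) k \<le> n}"
    have [measurable]: "(\<lambda>w. countdown Kst (?good w) k) \<in> ?P \<rightarrow>\<^sub>M count_space UNIV"
      by (rule measurable_countdown) (rule good_event)
    have C: "?C \<in> sets ?P" by measurable
    have "measure N {y \<in> space N. Y k y \<le> n} \<le> measure ?P ?C"
      using q by (intro countdown_dominated[OF P good_event good_cong _ _ _ Y Kst])
        (auto simp: good_iteration_def iter_upd intro: q_bound)
    also have "\<dots> = measure M ((\<lambda>x i. W i x) -` ?C \<inter> space M)"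
      using measure_distr[OF W_path C] by (simp add: distr)
    \<comment> \<open>By \<open>dom\<close>, the event that the countdown is at most
      \<open>n\<close> is contained in the one for \<open>X\<close>.\<close>
    also have "\<dots> \<le> measure M {x \<in> space M. X k x \<le> n}"
    proof (rule M.finite_measure_mono)
      note [measurable] = X_meas
      show "{x \<in> space M. X k x \<le> n} \<in> sets M" by measurable
    qed (use dom in \<open>fastforce intro: order_trans\<close>)
    finally show ?thesis .
  qed
  have "measure N {y \<in> space N. real (Y k y) \<le> \<eta>} \<le> measure M {x \<in> space M. real (X k x) \<le> \<eta>}"
    for k and \<eta> :: real
  \<comment> \<open>A nonnegative threshold may be replaced by its floor. For negative
    \<open>\<eta>\<close> this would be wrong at \<open>m = 0\<close>, since \<open>nat\<close>
    truncates to 0; there the left-hand event is empty.\<close>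
  proof (cases "0 \<le> \<eta>")
    case True
    then have "real m \<le> \<eta> \<longleftrightarrow> m \<le> nat \<lfloor>\<eta>\<rfloor>" for m
      by (simp add: le_nat_floor le_floor_iff nat_le_iff le_nat_iff)
    then show ?thesis using cdf by simp
  next
    case False
    then have "{y \<in> space N. real (Y k y) \<le> \<eta>} = {}" by auto
    then show ?thesis by (simp only: measure_empty measure_nonneg)
  qed
  moreover have "stoch_le M (\<lambda>x. real (X k x)) N (\<lambda>y. real (Y k y))" for k
    by (rule stoch_le_if_cdf_le[OF M X_meas N Y_meas cdf])
  ultimately show ?thesis by blast
qed

end
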